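(* Let $X$ be a Hausdorff space and let $G$ be a group of homeomorphisms of $X$ such that the orbit space $G\backslash X$ is a paracompact regular space. Then $G$ is isometrizable if and only if $G$ is equiregular.
   Context: Let $X$ be a topological space and $G$ a group of homeomorphisms of $X$. $G\backslash X$ denotes the orbit space with the quotient topology. Paracompact means that every open cover has a locally finite open refinement (Hausdorffness is NOT part of the definition). Regular means: for every point $x$ and every open neighborhood $U$ of $x$ there is an open neighborhood $V$ of $x$ with $\mathrm{cl}(V)\subset U$ (no further separation axiom is included). A gauge on $X$ is a function $\rho: X\times X\to[0,\infty)$ such that for all $x,y,z\in X$: (1) $\rho(x,x)=0$; (2) $\rho(x,y)=\rho(y,x)$; (3) $\rho(x,z)\le\rho(x,y)+\rho(y,z)$; (4) $\mathcal{N}_\rho(x,\epsilon)=\{y\in X:\rho(x,y)<\epsilon\}$ is an open subset of $X$ for all $x\in X$, $\epsilon\in(0,\infty)$. For a collection $\mathcal{P}$ of gauges on $X$, the topology determined by $\mathcal{P}$ is the topology on the set $X$ with subbasis $\{\mathcal{N}_\rho(x,\epsilon):\rho\in\mathcal{P},x\in X,\epsilon\in(0,\infty)\}$. $\mathcal{P}$ is separating if for all distinct $x,y\in X$ there is $\rho\in\mathcal{P}$ with $\rho(x,y)>0$. $\mathcal{P}$ is a gauge structure on $X$ if it is separating and determines the given topology of $X$. $\mathcal{P}$ is $G$-invariant if $\rho(g(x),g(y))=\rho(x,y)$ for all $x,y\in X$, $g\in G$, $\rho\in\mathcal{P}$. $G$ is isometrizable if $X$ has a $G$-invariant gauge structure.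 $G$ is equiregular if for every $x\in X$ and every open neighborhood $U$ of $x$ in $X$ there is an open neighborhood $V$ of $x$ in $X$ such that $\mathrm{cl}(V)\subset U$ and every $y\in X$ has an open neighborhood $N_y$ with the property that for every $g\in G$, if $g(N_y)\cap\mathrm{cl}(V)\ne\emptyset$, then $g(N_y)\subset U$. *)

theory Defs
  imports "HOL-Analysis.Analysis" "HOL-Algebra.Bij"
begin

section \<open>Groups of homeomorphisms and orbit spaces\<close>

(* Elements of the group are extensional functions on the underlying set of X, as in the group
   BijGroup, so that a self-homeomorphism of X is represented by exactly one HOL function. *)
definition homeomorphism_group :: "'a topology \<Rightarrow> ('a \<Rightarrow> 'a) set \<Rightarrow> bool" where
  "homeomorphism_group X G \<longleftrightarrow>
     subgroup G (BijGroup (topspace X)) \<and> (\<forall>g\<in>G. homeomorphic_map X X g)"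

definition orbit_of :: "('a \<Rightarrow> 'a) set \<Rightarrow> 'a \<Rightarrow> 'a set" where
  "orbit_of G x = (\<lambda>g. g x) ` G"

definition orbit_space :: "'a topology \<Rightarrow> ('a \<Rightarrow> 'a) set \<Rightarrow> 'a set topology" where
  "orbit_space X G = topology (\<lambda>W. W \<subseteq> orbit_of G ` topspace X \<and>
     openin X {x \<in> topspace X. orbit_of G x \<in> W})"

lemma openin_orbit_space:
  "openin (orbit_space X G) W \<longleftrightarrow>
     W \<subseteq> orbit_of G ` topspace X \<and> openin X {x \<in> topspace X. orbit_of G x \<in> W}"
proof -
  have "istopology (\<lambda>W. W \<subseteq> orbit_of G ` topspace X \<and>
     openin X {x \<in> topspace X. orbit_of G x \<in> W})"
    unfolding istopology_def
  proof (intro conjI allI impI; (elim conjE)?)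
    fix S T
    assume "openin X {x \<in> topspace X. orbit_of G x \<in> S}"
      and "openin X {x \<in> topspace X. orbit_of G x \<in> T}"
    then have "openin X ({x \<in> topspace X. orbit_of G x \<in> S} \<inter> {x \<in> topspace X. orbit_of G x \<in> T})"
      by (rule openin_Int)
    then show "openin X {x \<in> topspace X. orbit_of G x \<in> S \<inter> T}"
      by (rule back_subst[of "openin X"]) auto
  next
    fix \<K>
    assume K: "\<forall>K\<in>\<K>. K \<subseteq> orbit_of G ` topspace X \<and>
      openin X {x \<in> topspace X. orbit_of G x \<in> K}"
    then have "openin X (\<Union>K\<in>\<K>. {x \<in> topspace X. orbit_of G x \<in> K})"
      by (intro openin_Union) auto
    then show "openin X {x \<in> topspace X. orbit_of G x \<in> \<Union> \<K>}"
      by (rule back_subst[of "openin X"]) auto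
    show "\<Union> \<K> \<subseteq> orbit_of G ` topspace X"
      using K by blast
  qed auto
  then show ?thesis
    by (simp add: orbit_space_def topology_inverse')
qed

lemma topspace_orbit_space: "topspace (orbit_space X G) = orbit_of G ` topspace X"
proof -
  have "openin (orbit_space X G) (orbit_of G ` topspace X)"
    unfolding openin_orbit_space by (auto intro: back_subst[of "openin X", OF openin_topspace])
  then show ?thesis
    by (metis openin_orbit_space openin_subset openin_topspace subset_antisym)
qed

lemma quotient_map_orbit_of: "quotient_map X (orbit_space X G) (orbit_of G)"
  by (auto simp: quotient_map_def topspace_orbit_space openin_orbit_space)


section \<open>Paracompactness and regularity\<close>

definition paracompact_space :: "'a topology \<Rightarrow> bool" where
  "paracompact_space X \<longleftrightarrow>
     (\<forall>\<U>. (\<forall>U\<in>\<U>. openin X U) \<and> \<Union>\<U> = topspace X \<longrightarrow>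
        (\<exists>\<V>. (\<forall>V\<in>\<V>. openin X V) \<and> \<Union>\<V> = topspace X \<and>
             (\<forall>V\<in>\<V>. \<exists>U\<in>\<U>. V \<subseteq> U) \<and> locally_finite_in X \<V>))"

lemma regular_space_iff_closure_of:
  "regular_space X \<longleftrightarrow>
     (\<forall>x U. openin X U \<and> x \<in> U \<longrightarrow> (\<exists>V. openin X V \<and> x \<in> V \<and> X closure_of V \<subseteq> U))"
proof -
  have "(\<exists>V C. openin X V \<and> closedin X C \<and> x \<in> V \<and> V \<subseteq> C \<and> C \<subseteq> U) \<longleftrightarrow>
        (\<exists>V. openin X V \<and> x \<in> V \<and> X closure_of V \<subseteq> U)" for x U
    by (meson closedin_closure_of closure_of_minimal closure_of_subset openin_subset subset_trans)
  then show ?thesis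
    unfolding neighbourhood_base_of_closedin[symmetric] neighbourhood_base_of by auto
qed


section \<open>Gauge structures\<close>

definition gauge_ball :: "'a topology \<Rightarrow> ('a \<Rightarrow> 'a \<Rightarrow> real) \<Rightarrow> 'a \<Rightarrow> real \<Rightarrow> 'a set" where
  "gauge_ball X \<rho> x \<epsilon> = {y \<in> topspace X. \<rho> x y < \<epsilon>}"

(* Only the values on the underlying set of X matter; unrelated to the gauges of
   Henstock-Kurzweil integration. *)
definition gauge_on :: "'a topology \<Rightarrow> ('a \<Rightarrow> 'a \<Rightarrow> real) \<Rightarrow> bool" where
  "gauge_on X \<rho> \<longleftrightarrow>
     (\<forall>x\<in>topspace X. \<forall>y\<in>topspace X. 0 \<le> \<rho> x y) \<and>
     (\<forall>x\<in>topspace X. \<rho> x x = 0) \<and>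
     (\<forall>x\<in>topspace X. \<forall>y\<in>topspace X. \<rho> x y = \<rho> y x) \<and>
     (\<forall>x\<in>topspace X. \<forall>y\<in>topspace X. \<forall>z\<in>topspace X. \<rho> x z \<le> \<rho> x y + \<rho> y z) \<and>
     (\<forall>x\<in>topspace X. \<forall>\<epsilon>>0. openin X (gauge_ball X \<rho> x \<epsilon>))"

(* The topology on the set "topspace X" with the given subbasis. The relativised form is used
   rather than topology_generated_by because the latter has the union of the subbasis as its
   underlying set, which is wrong for the empty collection of gauges. *)
definition gauge_topology :: "'a topology \<Rightarrow> ('a \<Rightarrow> 'a \<Rightarrow> real) set \<Rightarrow> 'a topology" where
  "gauge_topology X P =
     topology (arbitrary union_of
       (finite intersection_of
          (\<lambda>S. \<exists>\<rho>\<in>P. \<exists>x\<in>topspace X. \<exists>\<epsilon>>0. S = gauge_ball X \<rho> x \<epsilon>)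
        relative_to topspace X))"

definition separating :: "'a topology \<Rightarrow> ('a \<Rightarrow> 'a \<Rightarrow> real) set \<Rightarrow> bool" where
  "separating X P \<longleftrightarrow>
     (\<forall>x\<in>topspace X. \<forall>y\<in>topspace X. x \<noteq> y \<longrightarrow> (\<exists>\<rho>\<in>P. \<rho> x y > 0))"

definition gauge_structure :: "'a topology \<Rightarrow> ('a \<Rightarrow> 'a \<Rightarrow> real) set \<Rightarrow> bool" where
  "gauge_structure X P \<longleftrightarrow>
     (\<forall>\<rho>\<in>P. gauge_on X \<rho>) \<and> separating X P \<and> gauge_topology X P = X"

definition gauges_invariant ::
    "'a topology \<Rightarrow> ('a \<Rightarrow> 'a) set \<Rightarrow> ('a \<Rightarrow> 'a \<Rightarrow> real) set \<Rightarrow> bool" where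
  "gauges_invariant X G P \<longleftrightarrow>
     (\<forall>\<rho>\<in>P. \<forall>g\<in>G. \<forall>x\<in>topspace X. \<forall>y\<in>topspace X. \<rho> (g x) (g y) = \<rho> x y)"

definition isometrizable :: "'a topology \<Rightarrow> ('a \<Rightarrow> 'a) set \<Rightarrow> bool" where
  "isometrizable X G \<longleftrightarrow> (\<exists>P. gauge_structure X P \<and> gauges_invariant X G P)"


section \<open>Equiregular groups\<close>

definition equiregular :: "'a topology \<Rightarrow> ('a \<Rightarrow> 'a) set \<Rightarrow> bool" where
  "equiregular X G \<longleftrightarrow>
     (\<forall>x U. openin X U \<and> x \<in> U \<longrightarrow>
        (\<exists>V. openin X V \<and> x \<in> V \<and> X closure_of V \<subseteq> U \<and>
             (\<forall>y\<in>topspace X. \<exists>N. openin X N \<and> y \<in> N \<and>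
                (\<forall>g\<in>G. g ` N \<inter> X closure_of V \<noteq> {} \<longrightarrow> g ` N \<subseteq> U))))"

end

(* An invariant gauge yields equiregularity by taking V and N_y to be balls of radius eps/3 and
   eps/6.  Conversely, when the orbit space is paracompact, equiregularity makes every invariant
   open cover of X have an invariant open star refinement.  Iterating gives a normal sequence of
   invariant covers, and the chain construction of the metrization lemma for uniformities turns it
   into an invariant gauge.  Starting from the cover by the translates g N_y that equiregularity
   provides for x and U, this gauge has a ball around x contained in U, so the collection of all
   invariant gauges is a gauge structure. *)

theory Submission
  imports Defs
begin

text \<open>The space X itself need not be paracompact, so arbitrary open covers of X are out of
  reach. Only covers closed under G are refined, since these can be compared with covers of the
  orbit space. The finite intersections are therefore indexed by members of a locally finite cover
  of the orbit space, and the many translates that lie over one such member are handled together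
  because the condition on N_y in equiregularity is uniform in g. Refinement by stars of sets fits
  the chain construction, which needs threefold composition: of three successively overlapping
  members, all lie in the star of the middle one.\<close>

section \<open>Groups of homeomorphisms\<close>

lemma homeomorphism_group_mapsto:
  assumes "homeomorphism_group X G" "g \<in> G" "x \<in> topspace X"
  shows "g x \<in> topspace X"
  using assms unfolding homeomorphism_group_def
  by (metis homeomorphic_imp_surjective_map imageI)

text \<open>Elements of \<open>BijGroup\<close> are extensional, so its unit, product and inverse
  agree with the ordinary ones only on \<open>topspace X\<close>. This lemma and the next two hide
  this by giving group elements with pointwise equations there.\<close>

lemma homeomorphism_group_id:
  assumes "homeomorphism_group X G"
  obtains e where "e \<in> G" "\<And>x. x \<in> topspace X \<Longrightarrow> e x = x"
proof -
  have "\<one>\<^bsub>BijGroup (topspace X)\<^esub> \<in> G"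
    using assms unfolding homeomorphism_group_def by (simp add: subgroup.one_closed)
  then show thesis
    by (intro that[of "\<one>\<^bsub>BijGroup (topspace X)\<^esub>"]) (auto simp: BijGroup_def)
qed

lemma homeomorphism_group_compose:
  assumes "homeomorphism_group X G" "g \<in> G" "h \<in> G"
  obtains k where "k \<in> G" "\<And>x. x \<in> topspace X \<Longrightarrow> k x = g (h x)"
proof -
  have G: "subgroup G (BijGroup (topspace X))"
    using assms unfolding homeomorphism_group_def by simp
  have "g \<in> Bij (topspace X)" "h \<in> Bij (topspace X)"
    using subgroup.subset[OF G] assms by (auto simp: BijGroup_def)
  moreover have "g \<otimes>\<^bsub>BijGroup (topspace X)\<^esub> h \<in> G"
    using subgroup.m_closed[OF G] assms by simp
  ultimately show thesis
    by (intro that[of "g \<otimes>\<^bsub>BijGroup (topspace X)\<^esub> h"])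
      (auto simp: BijGroup_def compose_eq)
qed

lemma homeomorphism_group_inverse:
  assumes "homeomorphism_group X G" "g \<in> G"
  obtains k where "k \<in> G" "\<And>x. x \<in> topspace X \<Longrightarrow> k (g x) = x"
    "\<And>x. x \<in> topspace X \<Longrightarrow> g (k x) = x"
proof -
  have G: "subgroup G (BijGroup (topspace X))"
    using assms unfolding homeomorphism_group_def by simp
  let ?k = "inv\<^bsub>BijGroup (topspace X)\<^esub> g"
  have g: "g \<in> Bij (topspace X)"
    using subgroup.subset[OF G] assms by (auto simp: BijGroup_def)
  have k: "?k \<in> G"
    using subgroup.m_inv_closed[OF G] assms by simp
  have bij: "bij_betw g (topspace X) (topspace X)"
    using g by (simp add: Bij_def)
  have eq: "?k x = inv_into (topspace X) g x" if "x \<in> topspace X" for x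
    using that g by (simp add: inv_BijGroup)
  show thesis
  proof (rule that[OF k])
    fix x assume x: "x \<in> topspace X"
    then have gx: "g x \<in> topspace X"
      using assms homeomorphism_group_mapsto by metis
    show "?k (g x) = x"
      using eq[OF gx] bij_betw_inv_into_left[OF bij x] by simp
    show "g (?k x) = x"
      using eq[OF x] bij_betw_inv_into_right[OF bij x] by simp
  qed
qed

lemma homeomorphism_group_openin_image:
  assumes "homeomorphism_group X G" "g \<in> G" "openin X U"
  shows "openin X (g ` U)"
  using assms unfolding homeomorphism_group_def
  by (metis homeomorphic_map_openness openin_subset)

section \<open>Orbits, and openness of the orbit map\<close>

lemma orbit_of_eq:
  assumes G: "homeomorphism_group X G" and "g \<in> G" "x \<in> topspace X"
  shows "orbit_of G (g x) = orbit_of G x"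
proof
  show "orbit_of G (g x) \<subseteq> orbit_of G x"
  proof
    fix y assume "y \<in> orbit_of G (g x)"
    then obtain h where h: "h \<in> G" "y = h (g x)" by (auto simp: orbit_of_def)
    obtain k where "k \<in> G" "\<And>x. x \<in> topspace X \<Longrightarrow> k x = h (g x)"
      using homeomorphism_group_compose[OF G h(1) assms(2)] by metis
    then show "y \<in> orbit_of G x" using assms h by (metis orbit_of_def imageI)
  qed
  obtain l where l: "l \<in> G" "\<And>x. x \<in> topspace X \<Longrightarrow> l (g x) = x"
    using homeomorphism_group_inverse[OF G assms(2)] by metis
  show "orbit_of G x \<subseteq> orbit_of G (g x)"
  proof
    fix y assume "y \<in> orbit_of G x"
    then obtain h where h: "h \<in> G" "y = h x" by (auto simp: orbit_of_def)
    obtain k where k: "k \<in> G" "\<And>x. x \<in> topspace X \<Longrightarrow> k x = h (l x)"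
      using homeomorphism_group_compose[OF G h(1) l(1)] by metis
    have "k (g x) = y"
      using k(2) l(2) h assms homeomorphism_group_mapsto by metis
    then show "y \<in> orbit_of G (g x)" using k by (metis orbit_of_def imageI)
  qed
qed

lemma orbit_of_self:
  assumes "homeomorphism_group X G" "x \<in> topspace X"
  shows "x \<in> orbit_of G x"
  using homeomorphism_group_id[OF assms(1)] assms(2) by (metis orbit_of_def imageI)

text \<open>The preimage of the image of \<open>V\<close> is the union of the translates of
  \<open>V\<close>. This lets open sets of X be pushed down to covers of the orbit space.\<close>

lemma openin_orbit_space_image:
  assumes G: "homeomorphism_group X G" and "openin X V"
  shows "openin (orbit_space X G) (orbit_of G ` V)"
proof -
  have VX: "V \<subseteq> topspace X" using assms openin_subset by blast
  have "{x \<in> topspace X. orbit_of G x \<in> orbit_of G ` V} = (\<Union>g\<in>G. g ` V)"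
  proof (intro equalityI subsetI)
    fix x assume "x \<in> {x \<in> topspace X. orbit_of G x \<in> orbit_of G ` V}"
    then obtain v where "x \<in> topspace X" "v \<in> V" "orbit_of G x = orbit_of G v" by auto
    then have "x \<in> orbit_of G v" using orbit_of_self[OF G] by metis
    then show "x \<in> (\<Union>g\<in>G. g ` V)" using \<open>v \<in> V\<close> by (auto simp: orbit_of_def)
  next
    fix x assume "x \<in> (\<Union>g\<in>G. g ` V)"
    then obtain g v where "g \<in> G" "v \<in> V" "x = g v" by auto
    then show "x \<in> {x \<in> topspace X. orbit_of G x \<in> orbit_of G ` V}"
      using orbit_of_eq[OF G] homeomorphism_group_mapsto[OF G] VX by (auto simp: subset_iff)
  qed
  moreover have "openin X (\<Union>g\<in>G. g ` V)"
    using homeomorphism_group_openin_image[OF G _ assms(2)] by blast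
  ultimately show ?thesis
    unfolding openin_orbit_space using VX by auto
qed


section \<open>Pseudometrics from normal sequences of entourages\<close>

text \<open>For a decreasing sequence this is \<open>(1/2) ^ n\<close> for the last \<open>n\<close>
  with \<open>(x, y) \<in> E n\<close>, and 0 if there is no last one. The real infimum of the empty
  set is unspecified; the assumption \<open>E_0\<close> below rules that case out for points of
  \<open>S\<close>.\<close>

definition entourage_size :: "(nat \<Rightarrow> ('a \<times> 'a) set) \<Rightarrow> 'a \<Rightarrow> 'a \<Rightarrow> real" where
  "entourage_size E x y = Inf ((\<lambda>n. (1/2) ^ n) ` {n. (x, y) \<in> E n})"

text \<open>Chains are total functions of which only the entries up to \<open>k\<close> count. The
  case \<open>k = 0\<close> is allowed and gives distance 0 from a point to itself.\<close>

definition chain_sums :: "'a set \<Rightarrow> (nat \<Rightarrow> ('a \<times> 'a) set) \<Rightarrow> 'a \<Rightarrow> 'a \<Rightarrow> real set" where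
  "chain_sums S E x y =
     {\<Sum>i<k. entourage_size E (p i) (p (Suc i)) | p k. p 0 = x \<and> p k = y \<and> range p \<subseteq> S}"

text \<open>Under the assumptions of \<open>normal_sequence\<close> this is the largest pseudometric
  on \<open>S\<close> below \<open>entourage_size E\<close>.\<close>

definition chain_dist :: "'a set \<Rightarrow> (nat \<Rightarrow> ('a \<times> 'a) set) \<Rightarrow> 'a \<Rightarrow> 'a \<Rightarrow> real" where
  "chain_dist S E x y = Inf (chain_sums S E x y)"

locale normal_sequence =
  fixes S :: "'a set" and E :: "nat \<Rightarrow> ('a \<times> 'a) set"
  assumes E_0: "E 0 = S \<times> S"
    and E_refl: "x \<in> S \<Longrightarrow> (x, x) \<in> E n"
    and E_sym: "(x, y) \<in> E n \<Longrightarrow> (y, x) \<in> E n"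
    and E_subset: "E n \<subseteq> S \<times> S"
    and E_comp: "(x, y) \<in> E (Suc n) \<Longrightarrow> (y, z) \<in> E (Suc n) \<Longrightarrow> (z, w) \<in> E (Suc n)
      \<Longrightarrow> (x, w) \<in> E n"
begin

lemma E_antimono: "m \<le> n \<Longrightarrow> E n \<subseteq> E m"
proof (rule lift_Suc_antimono_le[where f = E])
  fix n show "E (Suc n) \<subseteq> E n"
    using E_subset[of "Suc n"] E_comp E_refl by blast
qed

lemma size_bdd_below: "bdd_below ((\<lambda>n. (1/2::real) ^ n) ` {n. (x, y) \<in> E n})"
  by (rule bdd_belowI[of _ 0]) auto

lemma size_nonneg: "x \<in> S \<Longrightarrow> y \<in> S \<Longrightarrow> 0 \<le> entourage_size E x y"
  unfolding entourage_size_def using E_0 by (intro cInf_greatest) auto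

lemma size_le: "(x, y) \<in> E n \<Longrightarrow> entourage_size E x y \<le> (1/2) ^ n"
  unfolding entourage_size_def by (rule cInf_lower[OF _ size_bdd_below]) auto

text \<open>Sizes are infima of powers of 1/2, so a strict inequality gains a whole level:
  \<open>Suc n\<close> instead of \<open>n\<close>. The chain estimate depends on this gain.\<close>

lemma size_less:
  assumes "x \<in> S" "y \<in> S" "entourage_size E x y < (1/2) ^ n"
  shows "(x, y) \<in> E (Suc n)"
proof -
  have "(\<lambda>n. (1/2::real) ^ n) ` {n. (x, y) \<in> E n} \<noteq> {}"
    using E_0 assms by auto
  from cInf_lessD[OF this assms(3)[unfolded entourage_size_def]]
  obtain m where m: "(x, y) \<in> E m" "(1/2::real) ^ m < (1/2) ^ n" by auto
  have "Suc n \<le> m"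
  proof (rule ccontr)
    assume "\<not> Suc n \<le> m"
    then have "(1/2::real) ^ n \<le> (1/2) ^ m" by (intro power_decreasing) auto
    then show False using m by simp
  qed
  then show ?thesis using E_antimono m by blast
qed

lemma size_sym: "entourage_size E x y = entourage_size E y x"
proof -
  have "{n. (x, y) \<in> E n} = {n. (y, x) \<in> E n}" using E_sym by blast
  then show ?thesis unfolding entourage_size_def by simp
qed

text \<open>The heart of the metrization lemma. The chain is split into a head, one link and a tail.
  Head and tail each have at most half of the sum, so by induction they stay within
  \<open>E (Suc n)\<close>. The link may carry the whole sum, but that is still below
  \<open>(1/2) ^ n\<close>, so \<open>size_less\<close> puts it into \<open>E (Suc n)\<close> too,
  and \<open>E_comp\<close> joins the three. Both remaining index intervals are shorter than the
  original one, even when the head or tail is empty.\<close>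

lemma sum_size_less_imp:
  assumes p: "range p \<subseteq> S"
  shows "a \<le> b \<Longrightarrow> (\<Sum>i=a..<b. entourage_size E (p i) (p (Suc i))) < (1/2) ^ n
    \<Longrightarrow> (p a, p b) \<in> E n"
proof (induction "b - a" arbitrary: a b n rule: less_induct)
  case less
  let ?f = "\<lambda>i. entourage_size E (p i) (p (Suc i))"
  let ?T = "\<Sum>i=a..<b. ?f i"
  have pS: "p i \<in> S" for i using p by auto
  have f0: "0 \<le> ?f i" for i using size_nonneg pS by simp
  show ?case
  proof (cases "a = b")
    case True
    then show ?thesis using E_refl pS by simp
  next
    case False
    then have ab: "a < b" using less by simp
    have T0: "0 \<le> ?T" using f0 by (intro sum_nonneg) auto
    \<comment> \<open>Cut the chain at the step where the partial sums pass \<open>?T / 2\<close>.\<close>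
    let ?P = "\<lambda>j. a \<le> j \<and> j < b \<and> (\<Sum>i=a..<j. ?f i) \<le> ?T / 2"
    have Pa: "?P a" using ab T0 by simp
    define j where "j = (GREATEST j. ?P j)"
    have j: "?P j"
      unfolding j_def by (rule GreatestI_nat[of ?P a b]) (use Pa in auto)
    have jmax: "i \<le> j" if "?P i" for i
      unfolding j_def by (rule Greatest_le_nat[of ?P i b]) (use that in auto)
    have split1: "?T = (\<Sum>i=a..<Suc j. ?f i) + (\<Sum>i=Suc j..<b. ?f i)"
      by (rule sum.atLeastLessThan_concat[symmetric]) (use j in auto)
    have split2: "(\<Sum>i=a..<Suc j. ?f i) = (\<Sum>i=a..<j. ?f i) + ?f j"
      using j by simp
    have tail: "(\<Sum>i=Suc j..<b. ?f i) \<le> ?T / 2"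
    proof (cases "Suc j < b")
      case True
      then have "\<not> ?P (Suc j)" using jmax by fastforce
      then have "(\<Sum>i=a..<Suc j. ?f i) > ?T / 2" using True j by auto
      then show ?thesis using split1 by linarith
    next
      case False
      then show ?thesis using T0 by simp
    qed
    have half: "?T / 2 < (1/2) ^ Suc n" using less.prems by simp
    have "(p a, p j) \<in> E (Suc n)"
      using less.hyps[of j a "Suc n"] j half by force
    moreover have "(p (Suc j), p b) \<in> E (Suc n)"
      using less.hyps[of b "Suc j" "Suc n"] j half tail by force
    moreover have "(p j, p (Suc j)) \<in> E (Suc n)"
    proof (rule size_less)
      have "0 \<le> (\<Sum>i=a..<j. ?f i)" "0 \<le> (\<Sum>i=Suc j..<b. ?f i)"
        using f0 by (intro sum_nonneg; simp)+
      then show "?f j < (1/2) ^ n" using split1 split2 less.prems by linarith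
    qed (use pS in auto)
    ultimately show ?thesis using E_comp by blast
  qed
qed

section \<open>The infimum of chain sums as a pseudometric\<close>

lemma chain_sums_nonneg: "s \<in> chain_sums S E x y \<Longrightarrow> 0 \<le> s"
  unfolding chain_sums_def by (auto intro!: sum_nonneg size_nonneg)

lemma chain_sums_bdd_below: "bdd_below (chain_sums S E x y)"
  using chain_sums_nonneg by (rule bdd_belowI)

lemma size_in_chain_sums:
  assumes "x \<in> S" "y \<in> S"
  shows "entourage_size E x y \<in> chain_sums S E x y"
  unfolding chain_sums_def using assms
  by (intro CollectI exI[of _ "\<lambda>i. if i = 0 then x else y"] exI[of _ 1]) auto

lemma chain_sums_nonempty: "x \<in> S \<Longrightarrow> y \<in> S \<Longrightarrow> chain_sums S E x y \<noteq> {}"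
  using size_in_chain_sums by blast

lemma chain_dist_le_size: "x \<in> S \<Longrightarrow> y \<in> S \<Longrightarrow> chain_dist S E x y \<le> entourage_size E x y"
  unfolding chain_dist_def by (intro cInf_lower size_in_chain_sums chain_sums_bdd_below)

lemma chain_dist_le: "(x, y) \<in> E n \<Longrightarrow> chain_dist S E x y \<le> (1/2) ^ n"
  using chain_dist_le_size size_le E_subset by (meson mem_Sigma_iff order_trans subsetD)

lemma chain_dist_nonneg: "x \<in> S \<Longrightarrow> y \<in> S \<Longrightarrow> 0 \<le> chain_dist S E x y"
  unfolding chain_dist_def by (intro cInf_greatest chain_sums_nonempty chain_sums_nonneg)

lemma chain_dist_refl:
  assumes "x \<in> S"
  shows "chain_dist S E x x = 0"
proof (rule antisym)
  have "0 \<in> chain_sums S E x x"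
    unfolding chain_sums_def using assms
    by (intro CollectI exI[of _ "\<lambda>i. x"] exI[of _ 0]) auto
  then show "chain_dist S E x x \<le> 0"
    unfolding chain_dist_def by (intro cInf_lower chain_sums_bdd_below)
qed (use assms chain_dist_nonneg in auto)

lemma chain_sums_sym_subset: "chain_sums S E x y \<subseteq> chain_sums S E y x"
proof
  fix s assume "s \<in> chain_sums S E x y"
  then obtain p k where p: "p 0 = x" "p k = y" "range p \<subseteq> S"
    and s: "s = (\<Sum>i<k. entourage_size E (p i) (p (Suc i)))"
    unfolding chain_sums_def by blast
  have "s = (\<Sum>i<k. entourage_size E (p (k - Suc i)) (p (Suc (k - Suc i))))"
    unfolding s by (rule sum.nat_diff_reindex[symmetric])
  also have "\<dots> = (\<Sum>i<k. entourage_size E (p (k - i)) (p (k - Suc i)))"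
    by (intro sum.cong refl) (metis Suc_diff_Suc lessThan_iff size_sym)
  finally show "s \<in> chain_sums S E y x"
    unfolding chain_sums_def using p
    by (intro CollectI exI[of _ "\<lambda>i. p (k - i)"] exI[of _ k]) auto
qed

lemma chain_dist_sym: "chain_dist S E x y = chain_dist S E y x"
  unfolding chain_dist_def using chain_sums_sym_subset by (metis subset_antisym)

lemma chain_sums_add:
  assumes "s \<in> chain_sums S E x y" "t \<in> chain_sums S E y z"
  shows "s + t \<in> chain_sums S E x z"
proof -
  let ?f = "entourage_size E"
  obtain p k where p: "p 0 = x" "p k = y" "range p \<subseteq> S"
    and s: "s = (\<Sum>i<k. ?f (p i) (p (Suc i)))"
    using assms(1) unfolding chain_sums_def by blast
  obtain q l where q: "q 0 = y" "q l = z" "range q \<subseteq> S"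
    and t: "t = (\<Sum>i<l. ?f (q i) (q (Suc i)))"
    using assms(2) unfolding chain_sums_def by blast
  define r where "r = (\<lambda>i. if i \<le> k then p i else q (i - k))"
  have r: "r (k + i) = q i" for i
    using p q by (simp add: r_def)
  have "(\<Sum>i<k + l. F i) = (\<Sum>i<k. F i) + (\<Sum>i<l. F (k + i))" for F :: "nat \<Rightarrow> real"
    by (induction l) (simp_all add: add.assoc)
  then have "(\<Sum>i<k + l. ?f (r i) (r (Suc i))) =
      (\<Sum>i<k. ?f (r i) (r (Suc i))) + (\<Sum>i<l. ?f (r (k + i)) (r (k + Suc i)))"
    by simp
  also have "\<dots> = s + t"
    unfolding s t r by (simp add: r_def)
  finally have "s + t = (\<Sum>i<k + l. ?f (r i) (r (Suc i)))" ..
  moreover have "r 0 = x" "r (k + l) = z" "range r \<subseteq> S"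
    using p q r by (auto simp: r_def)
  ultimately show ?thesis
    unfolding chain_sums_def by blast
qed

lemma chain_dist_triangle:
  assumes "x \<in> S" "y \<in> S" "z \<in> S"
  shows "chain_dist S E x z \<le> chain_dist S E x y + chain_dist S E y z"
proof (rule field_le_epsilon)
  fix e :: real assume "0 < e"
  then have less: "chain_dist S E x y < chain_dist S E x y + e/2"
    "chain_dist S E y z < chain_dist S E y z + e/2" by auto
  obtain s where s: "s \<in> chain_sums S E x y" "s < chain_dist S E x y + e/2"
    using cInf_lessD[OF chain_sums_nonempty less(1)[unfolded chain_dist_def[of S E x y]]] assms
    unfolding chain_dist_def by auto
  obtain t where t: "t \<in> chain_sums S E y z" "t < chain_dist S E y z + e/2"
    using cInf_lessD[OF chain_sums_nonempty less(2)[unfolded chain_dist_def[of S E y z]]] assms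
    unfolding chain_dist_def by auto
  have "chain_dist S E x z \<le> s + t"
    unfolding chain_dist_def
    by (rule cInf_lower[OF chain_sums_add[OF s(1) t(1)] chain_sums_bdd_below])
  then show "chain_dist S E x z \<le> chain_dist S E x y + chain_dist S E y z + e"
    using s t by linarith
qed

text \<open>With \<open>chain_dist_le\<close> this places \<open>E n\<close> between the relations
  "distance < \<open>(1/2) ^ n\<close>" and "distance \<le> \<open>(1/2) ^ n\<close>". The upper
  bound will make balls open, the lower one will make them small.\<close>

lemma chain_dist_less_imp:
  assumes "x \<in> S" "y \<in> S" "chain_dist S E x y < (1/2) ^ n"
  shows "(x, y) \<in> E n"
proof -
  obtain s where "s \<in> chain_sums S E x y" "s < (1/2) ^ n"
    using cInf_lessD[OF chain_sums_nonempty assms(3)[unfolded chain_dist_def]] assms(1,2)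
    by blast
  then show ?thesis
    unfolding chain_sums_def using sum_size_less_imp[of _ 0] by (auto simp: lessThan_atLeast0)
qed

lemma size_image_le:
  assumes "x \<in> S" "y \<in> S" "\<And>n x y. (x, y) \<in> E n \<Longrightarrow> (g x, g y) \<in> E n"
  shows "entourage_size E (g x) (g y) \<le> entourage_size E x y"
  unfolding entourage_size_def
  by (rule cInf_superset_mono[OF _ size_bdd_below]) (use assms E_0 in auto)

text \<open>The image of a chain is a chain whose links are no larger. Only an inequality is claimed
  because \<open>g\<close> need not be invertible; for group elements the inverse supplies the other
  direction.\<close>

lemma chain_dist_image_le:
  assumes "x \<in> S" "y \<in> S" "g ` S \<subseteq> S" "\<And>n x y. (x, y) \<in> E n \<Longrightarrow> (g x, g y) \<in> E n"
  shows "chain_dist S E (g x) (g y) \<le> chain_dist S E x y"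
proof -
  have "chain_dist S E (g x) (g y) \<le> s" if s_in: "s \<in> chain_sums S E x y" for s
  proof -
    obtain p k where p: "p 0 = x" "p k = y" "range p \<subseteq> S"
      and s: "s = (\<Sum>i<k. entourage_size E (p i) (p (Suc i)))"
      using s_in unfolding chain_sums_def by blast
    have "(\<Sum>i<k. entourage_size E (g (p i)) (g (p (Suc i)))) \<in> chain_sums S E (g x) (g y)"
      unfolding chain_sums_def using p assms(3)
      by (intro CollectI exI[of _ "\<lambda>i. g (p i)"] exI[of _ k]) auto
    then have "chain_dist S E (g x) (g y) \<le> (\<Sum>i<k. entourage_size E (g (p i)) (g (p (Suc i))))"
      unfolding chain_dist_def by (intro cInf_lower chain_sums_bdd_below)
    also have "\<dots> \<le> s"
      unfolding s using p assms(4) by (intro sum_mono size_image_le) auto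
    finally show ?thesis .
  qed
  then show ?thesis
    using chain_sums_nonempty[OF assms(1,2)] unfolding chain_dist_def[of S E x y]
    by (intro cInf_greatest)
qed

end


section \<open>Invariant gauges\<close>

definition invariant_gauges :: "'a topology \<Rightarrow> ('a \<Rightarrow> 'a) set \<Rightarrow> ('a \<Rightarrow> 'a \<Rightarrow> real) set" where
  "invariant_gauges X G = {\<rho>. gauge_on X \<rho> \<and> gauges_invariant X G {\<rho>}}"

lemma gauge_onD:
  assumes "gauge_on X \<rho>" "x \<in> topspace X"
  shows "y \<in> topspace X \<Longrightarrow> 0 \<le> \<rho> x y" "\<rho> x x = 0"
    "y \<in> topspace X \<Longrightarrow> \<rho> x y = \<rho> y x"
    "y \<in> topspace X \<Longrightarrow> z \<in> topspace X \<Longrightarrow> \<rho> x z \<le> \<rho> x y + \<rho> y z"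
    "0 < \<epsilon> \<Longrightarrow> openin X (gauge_ball X \<rho> x \<epsilon>)"
  using assms unfolding gauge_on_def by blast+

lemma gauge_ball_subset_shift:
  assumes "gauge_on X \<rho>" "a \<in> topspace X" "x \<in> gauge_ball X \<rho> a \<delta>"
  shows "\<delta> - \<rho> a x > 0" "gauge_ball X \<rho> x (\<delta> - \<rho> a x) \<subseteq> gauge_ball X \<rho> a \<delta>"
proof -
  have x: "x \<in> topspace X" "\<rho> a x < \<delta>" using assms by (auto simp: gauge_ball_def)
  show "\<delta> - \<rho> a x > 0" using x by simp
  show "gauge_ball X \<rho> x (\<delta> - \<rho> a x) \<subseteq> gauge_ball X \<rho> a \<delta>"
    using gauge_onD(4)[OF assms(1,2) x(1)] by (fastforce simp: gauge_ball_def)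
qed

lemma zero_invariant_gauge: "(\<lambda>x y. 0) \<in> invariant_gauges X G"
  by (auto simp: invariant_gauges_def gauge_on_def gauges_invariant_def gauge_ball_def)

lemma gauge_on_add:
  assumes "gauge_on X \<rho>" "gauge_on X \<sigma>"
  shows "gauge_on X (\<lambda>x y. \<rho> x y + \<sigma> x y)"
proof -
  let ?\<tau> = "\<lambda>x y. \<rho> x y + \<sigma> x y"
  have "openin X (gauge_ball X ?\<tau> x \<epsilon>)" if x: "x \<in> topspace X" for x \<epsilon>
  proof (subst openin_subopen, intro ballI)
    fix y assume y: "y \<in> gauge_ball X ?\<tau> x \<epsilon>"
    then have yX: "y \<in> topspace X" and less: "?\<tau> x y < \<epsilon>" by (auto simp: gauge_ball_def)
    define \<delta> where "\<delta> = (\<epsilon> - ?\<tau> x y) / 2"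
    have \<delta>: "0 < \<delta>" using less by (simp add: \<delta>_def)
    let ?T = "gauge_ball X \<rho> y \<delta> \<inter> gauge_ball X \<sigma> y \<delta>"
    have "openin X ?T"
      by (intro openin_Int gauge_onD(5) assms yX \<delta>)
    moreover have "y \<in> ?T"
      using gauge_onD(2)[OF assms(1) yX] gauge_onD(2)[OF assms(2) yX] yX \<delta>
      by (simp add: gauge_ball_def)
    moreover have "?T \<subseteq> gauge_ball X ?\<tau> x \<epsilon>"
    proof
      fix z assume z: "z \<in> ?T"
      then have zX: "z \<in> topspace X" "\<rho> y z < \<delta>" "\<sigma> y z < \<delta>" by (auto simp: gauge_ball_def)
      have "\<rho> x z \<le> \<rho> x y + \<rho> y z" "\<sigma> x z \<le> \<sigma> x y + \<sigma> y z"
        using gauge_onD(4)[OF assms(1) x yX zX(1)] gauge_onD(4)[OF assms(2) x yX zX(1)] .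
      then have "?\<tau> x z < ?\<tau> x y + 2 * \<delta>" using zX by linarith
      also have "\<dots> = \<epsilon>" by (simp add: \<delta>_def field_simps)
      finally show "z \<in> gauge_ball X ?\<tau> x \<epsilon>"
        using zX by (simp add: gauge_ball_def)
    qed
    ultimately show "\<exists>T. openin X T \<and> y \<in> T \<and> T \<subseteq> gauge_ball X ?\<tau> x \<epsilon>" by blast
  qed
  moreover have "?\<tau> x z \<le> ?\<tau> x y + ?\<tau> y z"
    if "x \<in> topspace X" "y \<in> topspace X" "z \<in> topspace X" for x y z
    using gauge_onD(4)[OF assms(1) that] gauge_onD(4)[OF assms(2) that] by linarith
  moreover have "0 \<le> ?\<tau> x y" "?\<tau> x x = 0" "?\<tau> x y = ?\<tau> y x"
    if "x \<in> topspace X" "y \<in> topspace X" for x y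
    using gauge_onD(1-3)[OF assms(1) that(1)] gauge_onD(1-3)[OF assms(2) that(1)] that(2)
    by auto
  ultimately show ?thesis unfolding gauge_on_def by blast
qed

text \<open>Sums replace finite families of gauges by a single one: a ball of the sum lies in the
  balls of the same centre and radius of both summands.\<close>

lemma add_invariant_gauge:
  assumes "\<rho> \<in> invariant_gauges X G" "\<sigma> \<in> invariant_gauges X G"
  shows "(\<lambda>x y. \<rho> x y + \<sigma> x y) \<in> invariant_gauges X G"
  using assms gauge_on_add by (auto simp: invariant_gauges_def gauges_invariant_def)

text \<open>A basic open set involves finitely many gauges and balls not centred at
  \<open>x\<close>. The sets that contain, around each of their points, a ball of one invariant
  gauge form a topology \<open>L\<close> containing the subbasis, hence the whole gauge topology.
  The gauge obtained need not belong to \<open>P\<close>; it may be a sum of members.\<close>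

lemma gauge_topology_ball_subset:
  assumes P: "P \<subseteq> invariant_gauges X G"
    and U: "openin (gauge_topology X P) U" and x: "x \<in> U"
  obtains \<sigma> \<epsilon> where "\<sigma> \<in> invariant_gauges X G" "\<epsilon> > 0" "gauge_ball X \<sigma> x \<epsilon> \<subseteq> U"
    "x \<in> topspace X"
proof -
  define L where "L = (\<lambda>U. U \<subseteq> topspace X \<and>
    (\<forall>x\<in>U. \<exists>\<sigma>\<in>invariant_gauges X G. \<exists>\<epsilon>>0. gauge_ball X \<sigma> x \<epsilon> \<subseteq> U))"
  have "istopology L"
    unfolding istopology_def
  proof (intro conjI allI impI)
    fix A B assume A: "L A" and B: "L B"
    have "\<exists>\<sigma>\<in>invariant_gauges X G. \<exists>\<epsilon>>0. gauge_ball X \<sigma> x \<epsilon> \<subseteq> A \<inter> B" if x: "x \<in> A \<inter> B" for x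
    proof -
      obtain \<rho> d where \<rho>: "\<rho> \<in> invariant_gauges X G" "d > 0" "gauge_ball X \<rho> x d \<subseteq> A"
        using A x unfolding L_def by blast
      obtain \<sigma> e where \<sigma>: "\<sigma> \<in> invariant_gauges X G" "e > 0" "gauge_ball X \<sigma> x e \<subseteq> B"
        using B x unfolding L_def by blast
      have xX: "x \<in> topspace X" using A x unfolding L_def by blast
      have "gauge_ball X (\<lambda>x y. \<rho> x y + \<sigma> x y) x (min d e) \<subseteq> A \<inter> B"
      proof
        fix y assume y: "y \<in> gauge_ball X (\<lambda>x y. \<rho> x y + \<sigma> x y) x (min d e)"
        then have yX: "y \<in> topspace X" by (simp add: gauge_ball_def)
        have "0 \<le> \<rho> x y" "0 \<le> \<sigma> x y"
          using \<rho>(1) \<sigma>(1) gauge_onD(1)[OF _ xX yX] unfolding invariant_gauges_def by auto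
        then have "y \<in> gauge_ball X \<rho> x d" "y \<in> gauge_ball X \<sigma> x e"
          using y by (auto simp: gauge_ball_def)
        then show "y \<in> A \<inter> B" using \<rho> \<sigma> by blast
      qed
      then show ?thesis
        using add_invariant_gauge[OF \<rho>(1) \<sigma>(1)] \<rho>(2) \<sigma>(2) by (metis min_less_iff_conj)
    qed
    then show "L (A \<inter> B)" using A unfolding L_def by blast
  next
    fix \<K> assume K: "\<forall>K\<in>\<K>. L K"
    then show "L (\<Union>\<K>)" unfolding L_def by (meson Union_iff Sup_upper Union_least order_trans)
  qed
  then have L: "openin (topology L) A \<longleftrightarrow> L A" for A by (simp add: topology_inverse')
  have "openin (topology L) U"
  proof (rule minimal_topology_subbase[OF _ _ U[unfolded gauge_topology_def]])
    \<comment> \<open>The zero gauge serves here, even when \<open>P\<close> is empty.\<close>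
    have "L (topspace X)"
      unfolding L_def gauge_ball_def
      using zero_invariant_gauge[of X G] zero_less_one[where 'a = real] by blast
    then show "openin (topology L) (topspace X)" using L by blast
  next
    fix A assume "\<exists>\<rho>\<in>P. \<exists>x\<in>topspace X. \<exists>\<epsilon>>0. A = gauge_ball X \<rho> x \<epsilon>"
    then obtain \<rho> a \<delta> where A: "\<rho> \<in> P" "a \<in> topspace X" "A = gauge_ball X \<rho> a \<delta>" by blast
    then have \<rho>: "\<rho> \<in> invariant_gauges X G" "gauge_on X \<rho>"
      using P by (auto simp: invariant_gauges_def)
    have "A \<subseteq> topspace X" using A(3) by (auto simp: gauge_ball_def)
    then have "L A"
      unfolding L_def using gauge_ball_subset_shift[OF \<rho>(2) A(2)] \<rho>(1) A(3) by blast
    then show "openin (topology L) A" using L by blast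
  qed
  then have "L U" using L by blast
  then show thesis using that x unfolding L_def by blast
qed

lemma isometrizable_imp_equiregular:
  assumes G: "homeomorphism_group X G" and "isometrizable X G"
  shows "equiregular X G"
  unfolding equiregular_def
proof (intro allI impI, elim conjE)
  fix x U assume U: "openin X U" "x \<in> U"
  obtain P where P: "gauge_structure X P" "gauges_invariant X G P"
    using assms unfolding isometrizable_def by blast
  have "P \<subseteq> invariant_gauges X G"
    using P by (auto simp: invariant_gauges_def gauge_structure_def gauges_invariant_def)
  moreover have "openin (gauge_topology X P) U"
    using P U by (simp add: gauge_structure_def)
  ultimately obtain \<sigma> \<epsilon> where \<sigma>: "\<sigma> \<in> invariant_gauges X G" "\<epsilon> > 0" "gauge_ball X \<sigma> x \<epsilon> \<subseteq> U"
    and x: "x \<in> topspace X"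
    using gauge_topology_ball_subset U by metis
  have gauge: "gauge_on X \<sigma>"
    and inv: "\<And>g y z. g \<in> G \<Longrightarrow> y \<in> topspace X \<Longrightarrow> z \<in> topspace X \<Longrightarrow> \<sigma> (g y) (g z) = \<sigma> y z"
    using \<sigma>(1) by (auto simp: invariant_gauges_def gauges_invariant_def)
  note tri = gauge_onD(4)[OF gauge] and sym = gauge_onD(3)[OF gauge]
  let ?V = "gauge_ball X \<sigma> x (\<epsilon>/3)"
  have ball: "openin X (gauge_ball X \<sigma> y \<delta>)" "y \<in> gauge_ball X \<sigma> y \<delta>"
    if "y \<in> topspace X" "\<delta> > 0" for y \<delta>
    using gauge_onD(2,5)[OF gauge that(1)] that by (auto simp: gauge_ball_def)
  have V: "openin X ?V" "x \<in> ?V"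
    using ball x \<sigma>(2) by auto
  \<comment> \<open>Budget: closure points of \<open>?V\<close> are within
    \<open>\<epsilon>/3 + \<epsilon>/6 = \<epsilon>/2\<close> of \<open>x\<close>, and two points of
    a ball of radius \<open>\<epsilon>/6\<close> are less than \<open>\<epsilon>/3\<close> apart.
    The total is less than \<open>\<epsilon>\<close>.\<close>
  have cl: "y \<in> topspace X \<and> \<sigma> x y < \<epsilon>/2" if y: "y \<in> X closure_of ?V" for y
  proof -
    have yX: "y \<in> topspace X" using y by (simp add: in_closure_of)
    have "openin X (gauge_ball X \<sigma> y (\<epsilon>/6))" "y \<in> gauge_ball X \<sigma> y (\<epsilon>/6)"
      using ball[OF yX] \<sigma>(2) by auto
    then obtain z where "z \<in> ?V" "z \<in> gauge_ball X \<sigma> y (\<epsilon>/6)"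
      using y by (meson in_closure_of)
    then show ?thesis
      using tri[OF x, of z y] sym[OF yX, of z] yX by (auto simp: gauge_ball_def)
  qed
  have N: "\<exists>N. openin X N \<and> y \<in> N \<and>
        (\<forall>g\<in>G. g ` N \<inter> X closure_of ?V \<noteq> {} \<longrightarrow> g ` N \<subseteq> U)" if y: "y \<in> topspace X" for y
  proof (intro exI[of _ "gauge_ball X \<sigma> y (\<epsilon>/6)"] conjI ballI impI subsetI)
    show "openin X (gauge_ball X \<sigma> y (\<epsilon>/6))" "y \<in> gauge_ball X \<sigma> y (\<epsilon>/6)"
      using ball[OF y] \<sigma>(2) by auto
    fix g w assume g: "g \<in> G" and "g ` gauge_ball X \<sigma> y (\<epsilon>/6) \<inter> X closure_of ?V \<noteq> {}"
      and "w \<in> g ` gauge_ball X \<sigma> y (\<epsilon>/6)"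
    then obtain a b where a: "a \<in> topspace X" "\<sigma> y a < \<epsilon>/6" "w = g a"
      and b: "b \<in> topspace X" "\<sigma> y b < \<epsilon>/6" "g b \<in> X closure_of ?V"
      by (auto simp: gauge_ball_def)
    have "\<sigma> b a \<le> \<sigma> b y + \<sigma> y a" "\<sigma> b y = \<sigma> y b"
      using tri[OF b(1) y a(1)] sym[OF b(1) y] by auto
    \<comment> \<open>Invariance makes this bound independent of \<open>g\<close>, which is why one
      neighbourhood of \<open>y\<close> serves the whole group.\<close>
    then have "\<sigma> (g b) (g a) < \<epsilon>/3" using inv[OF g b(1) a(1)] a b by linarith
    moreover have "g a \<in> topspace X" "g b \<in> topspace X"
      using homeomorphism_group_mapsto[OF G g] a b by auto
    ultimately have "w \<in> gauge_ball X \<sigma> x \<epsilon>"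
      using tri[OF x, of "g b" "g a"] cl[OF b(3)] a(3) \<sigma>(2) by (simp add: gauge_ball_def)
    then show "w \<in> U" using \<sigma>(3) by blast
  qed
  have "X closure_of ?V \<subseteq> U"
    using cl \<sigma>(2,3) by (force simp: gauge_ball_def)
  then show "\<exists>V. openin X V \<and> x \<in> V \<and> X closure_of V \<subseteq> U \<and>
      (\<forall>y\<in>topspace X. \<exists>N. openin X N \<and> y \<in> N \<and>
        (\<forall>g\<in>G. g ` N \<inter> X closure_of V \<noteq> {} \<longrightarrow> g ` N \<subseteq> U))"
    using V N by blast
qed

text \<open>Separation comes from the ball condition at \<open>x\<close> for the complement of
  \<open>y\<close>, which is open because X is Hausdorff. For the topology, one inclusion is
  openness of gauge balls and the other is the ball condition itself.\<close>

lemma isometrizableI: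
  assumes X: "Hausdorff_space X"
    and ball: "\<And>x U. openin X U \<Longrightarrow> x \<in> U \<Longrightarrow>
      \<exists>\<sigma>\<in>invariant_gauges X G. \<exists>\<epsilon>>0. gauge_ball X \<sigma> x \<epsilon> \<subseteq> U"
  shows "isometrizable X G"
proof -
  let ?P = "invariant_gauges X G"
  have gauge: "gauge_on X \<rho>" if "\<rho> \<in> ?P" for \<rho> using that by (simp add: invariant_gauges_def)
  have "separating X ?P"
    unfolding separating_def
  proof (intro ballI impI)
    fix x y assume xy: "x \<in> topspace X" "y \<in> topspace X" "x \<noteq> y"
    have "openin X (topspace X - {y})"
      using X xy by (simp add: closedin_Hausdorff_singleton openin_diff)
    then obtain \<sigma> \<epsilon> where \<sigma>: "\<sigma> \<in> ?P" "\<epsilon> > 0" "gauge_ball X \<sigma> x \<epsilon> \<subseteq> topspace X - {y}"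
      using ball xy by blast
    then have "\<sigma> x y \<ge> \<epsilon>" using xy by (force simp: gauge_ball_def)
    then have "\<sigma> x y > 0" using \<sigma>(2) by linarith
    then show "\<exists>\<rho>\<in>?P. \<rho> x y > 0" using \<sigma>(1) by blast
  qed
  moreover have "gauge_topology X ?P = X"
    unfolding topology_eq
  proof (intro allI iffI)
    let ?B = "\<lambda>S. \<exists>\<rho>\<in>?P. \<exists>x\<in>topspace X. \<exists>\<epsilon>>0. S = gauge_ball X \<rho> x \<epsilon>"
    fix U
    show "openin X U" if "openin (gauge_topology X ?P) U"
      by (rule minimal_topology_subbase[OF _ _ that[unfolded gauge_topology_def]])
        (use gauge_onD(5)[OF gauge] in auto)
    assume U: "openin X U"
    show "openin (gauge_topology X ?P) U"
    proof (subst openin_subopen, intro ballI)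
      fix x assume x: "x \<in> U"
      then have xX: "x \<in> topspace X" using U openin_subset by blast
      obtain \<sigma> \<epsilon> where \<sigma>: "\<sigma> \<in> ?P" "\<epsilon> > 0" "gauge_ball X \<sigma> x \<epsilon> \<subseteq> U"
        using ball U x by blast
      have "openin (gauge_topology X ?P) (gauge_ball X \<sigma> x \<epsilon>)"
      proof -
        have "topspace X \<inter> gauge_ball X \<sigma> x \<epsilon> = gauge_ball X \<sigma> x \<epsilon>"
          by (auto simp: gauge_ball_def)
        moreover have "(finite intersection_of ?B) (gauge_ball X \<sigma> x \<epsilon>)"
          by (rule finite_intersection_of_inc) (use \<sigma> xX in blast)
        ultimately have "(finite intersection_of ?B relative_to topspace X) (gauge_ball X \<sigma> x \<epsilon>)"
          unfolding relative_to_def by (intro exI[of _ "gauge_ball X \<sigma> x \<epsilon>"] conjI)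
        then show ?thesis
          unfolding gauge_topology_def openin_subbase by (rule arbitrary_union_of_inc)
      qed
      moreover have "x \<in> gauge_ball X \<sigma> x \<epsilon>"
        using gauge_onD(2)[OF gauge[OF \<sigma>(1)] xX] \<sigma>(2) xX by (simp add: gauge_ball_def)
      ultimately show "\<exists>T. openin (gauge_topology X ?P) T \<and> x \<in> T \<and> T \<subseteq> U"
        using \<sigma>(3) by blast
    qed
  qed
  ultimately have "gauge_structure X ?P"
    using gauge by (simp add: gauge_structure_def)
  moreover have "gauges_invariant X G ?P"
    by (auto simp: invariant_gauges_def gauges_invariant_def)
  ultimately show ?thesis unfolding isometrizable_def by blast
qed


section \<open>Invariant open covers\<close>

definition invariant_open_cover :: "'a topology \<Rightarrow> ('a \<Rightarrow> 'a) set \<Rightarrow> 'a set set \<Rightarrow> bool" where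
  "invariant_open_cover X G \<U> \<longleftrightarrow>
     (\<forall>U\<in>\<U>. openin X U) \<and> \<Union>\<U> = topspace X \<and> (\<forall>g\<in>G. \<forall>U\<in>\<U>. g ` U \<in> \<U>)"

text \<open>The star is taken around a member of the cover, not around a point, so that it absorbs a
  chain of three overlapping members.\<close>

definition star_refines :: "'a set set \<Rightarrow> 'a set set \<Rightarrow> bool" where
  "star_refines \<V> \<U> \<longleftrightarrow> (\<forall>V\<in>\<V>. \<exists>U\<in>\<U>. \<forall>V'\<in>\<V>. V \<inter> V' \<noteq> {} \<longrightarrow> V' \<subseteq> U)"

text \<open>Used twice: for the star refinements, and for the starting cover of the final
  construction.\<close>

lemma invariant_open_cover_translates:
  assumes G: "homeomorphism_group X G"
    and N: "\<And>y. y \<in> topspace X \<Longrightarrow> openin X (N y) \<and> y \<in> N y"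
  shows "invariant_open_cover X G {g ` N y | g y. g \<in> G \<and> y \<in> topspace X}"
  unfolding invariant_open_cover_def
proof (intro conjI ballI)
  let ?\<U> = "{g ` N y | g y. g \<in> G \<and> y \<in> topspace X}"
  show op: "openin X U" if "U \<in> ?\<U>" for U
    using that homeomorphism_group_openin_image[OF G] N by auto
  obtain e where e: "e \<in> G" "\<And>x. x \<in> topspace X \<Longrightarrow> e x = x"
    using homeomorphism_group_id[OF G] by blast
  have "y \<in> \<Union>?\<U>" if "y \<in> topspace X" for y
  proof
    show "y \<in> e ` N y" using N[OF that] e(2)[OF that] by (intro image_eqI[of _ _ y]) auto
    show "e ` N y \<in> ?\<U>" using e that by blast
  qed
  then have "topspace X \<subseteq> \<Union>?\<U>" by (rule subsetI)
  with Union_least[OF openin_subset[OF op]] show "\<Union>?\<U> = topspace X" by (rule subset_antisym)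
  fix h U assume h: "h \<in> G" and "U \<in> ?\<U>"
  then obtain g y where g: "g \<in> G" "y \<in> topspace X" "U = g ` N y" by blast
  obtain k where k: "k \<in> G" "\<And>x. x \<in> topspace X \<Longrightarrow> k x = h (g x)"
    using homeomorphism_group_compose[OF G h g(1)] by blast
  have "N y \<subseteq> topspace X" using N[OF g(2)] openin_subset by blast
  then have "h ` U = k ` N y"
    unfolding g(3) image_image using k(2) by (intro image_cong refl) auto
  then show "h ` U \<in> ?\<U>" using k g by blast
qed

lemma equiregularE:
  assumes "equiregular X G" "openin X U" "x \<in> U"
  obtains V N where "openin X V" "x \<in> V"
    "\<forall>y\<in>topspace X. openin X (N y) \<and> y \<in> N y \<and> (\<forall>g\<in>G. g ` N y \<inter> V \<noteq> {} \<longrightarrow> g ` N y \<subseteq> U)"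
proof -
  from assms(1)[unfolded equiregular_def, rule_format, OF conjI[OF assms(2,3)]]
  obtain V where V: "openin X V" "x \<in> V"
    and N: "\<forall>y\<in>topspace X. \<exists>N. openin X N \<and> y \<in> N \<and>
      (\<forall>g\<in>G. g ` N \<inter> X closure_of V \<noteq> {} \<longrightarrow> g ` N \<subseteq> U)"
    by (elim exE conjE)
  from bchoice[OF N] obtain N where N: "\<forall>y\<in>topspace X. openin X (N y) \<and> y \<in> N y \<and>
      (\<forall>g\<in>G. g ` N y \<inter> X closure_of V \<noteq> {} \<longrightarrow> g ` N y \<subseteq> U)"
    by (elim exE)
  have "V \<subseteq> X closure_of V"
    using V(1) by (simp add: closure_of_subset openin_subset)
  then have "g ` N y \<inter> X closure_of V \<noteq> {}" if "g ` N y \<inter> V \<noteq> {}" for g y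
    using that by blast
  with N show thesis by (intro that[OF V, of N] ballI conjI impI) auto
qed

text \<open>A member of the new cover lies in a translate of some \<open>V x\<close> under a group
  element \<open>k\<close>. Pulling everything back by \<open>k\<close> turns a meeting with another
  member into a meeting with \<open>V x\<close> itself, where equiregularity confines that other
  member to \<open>U x\<close>. Pushing forward again confines it to the image of \<open>U x\<close>
  under \<open>k\<close>, a member of the given cover by invariance.\<close>

lemma invariant_star_refinement:
  assumes G: "homeomorphism_group X G"
    and para: "paracompact_space (orbit_space X G)"
    and equi: "equiregular X G"
    and cover: "invariant_open_cover X G \<U>"
  obtains \<V> where "invariant_open_cover X G \<V>" "star_refines \<V> \<U>"
proof -
  let ?S = "topspace X" and ?Q = "orbit_space X G"
  have "\<exists>U V N. U \<in> \<U> \<and> openin X V \<and> x \<in> V \<and>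
      (\<forall>y\<in>?S. openin X (N y) \<and> y \<in> N y \<and> (\<forall>g\<in>G. g ` N y \<inter> V \<noteq> {} \<longrightarrow> g ` N y \<subseteq> U))"
    if x: "x \<in> ?S" for x
  proof -
    obtain U where U: "U \<in> \<U>" "x \<in> U" "openin X U"
      using cover x unfolding invariant_open_cover_def by blast
    show ?thesis
      by (rule equiregularE[OF equi U(3,2)]) (use U(1) in blast)
  qed
  then have "\<forall>x\<in>?S. \<exists>U V N. U \<in> \<U> \<and> openin X V \<and> x \<in> V \<and>
      (\<forall>y\<in>?S. openin X (N y) \<and> y \<in> N y \<and> (\<forall>g\<in>G. g ` N y \<inter> V \<noteq> {} \<longrightarrow> g ` N y \<subseteq> U))"
    by blast
  then obtain U V N where UVN: "\<forall>x\<in>?S. U x \<in> \<U> \<and> openin X (V x) \<and> x \<in> V x \<and>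
      (\<forall>y\<in>?S. openin X (N x y) \<and> y \<in> N x y \<and>
        (\<forall>g\<in>G. g ` N x y \<inter> V x \<noteq> {} \<longrightarrow> g ` N x y \<subseteq> U x))"
    unfolding bchoice_iff by blast
  have "\<exists>\<W>. (\<forall>W\<in>\<W>. openin ?Q W) \<and> \<Union>\<W> = topspace ?Q \<and>
      (\<forall>W\<in>\<W>. \<exists>A\<in>(\<lambda>x. orbit_of G ` V x) ` ?S. W \<subseteq> A) \<and> locally_finite_in ?Q \<W>"
  proof (rule para[unfolded paracompact_space_def, rule_format], intro conjI ballI)
    show op: "openin ?Q A" if "A \<in> (\<lambda>x. orbit_of G ` V x) ` ?S" for A
      using that UVN openin_orbit_space_image[OF G] by auto
    have "topspace ?Q \<subseteq> \<Union>((\<lambda>x. orbit_of G ` V x) ` ?S)"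
    proof
      fix q assume "q \<in> topspace ?Q"
      then obtain x where x: "x \<in> ?S" "q = orbit_of G x" by (auto simp: topspace_orbit_space)
      then have "x \<in> V x" using UVN by blast
      then show "q \<in> \<Union>((\<lambda>x. orbit_of G ` V x) ` ?S)" using x by blast
    qed
    with Union_least[OF openin_subset[OF op]]
    show "\<Union>((\<lambda>x. orbit_of G ` V x) ` ?S) = topspace ?Q" by (rule subset_antisym)
  qed
  then obtain \<W> where \<W>: "\<forall>W\<in>\<W>. openin ?Q W" "\<Union>\<W> = topspace ?Q"
      "\<forall>W\<in>\<W>. \<exists>x\<in>?S. W \<subseteq> orbit_of G ` V x" "locally_finite_in ?Q \<W>"
    by auto
  from bchoice[OF \<W>(3)[unfolded Bex_def]]
  obtain c where "\<forall>W\<in>\<W>. c W \<in> ?S \<and> W \<subseteq> orbit_of G ` V (c W)" by (elim exE)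
  then have c: "\<And>W. W \<in> \<W> \<Longrightarrow> c W \<in> ?S" "\<And>W. W \<in> \<W> \<Longrightarrow> W \<subseteq> orbit_of G ` V (c W)"
    by auto
  have "\<exists>B W h. openin ?Q B \<and> orbit_of G y \<in> B \<and> finite {A \<in> \<W>. A \<inter> B \<noteq> {}} \<and>
      W \<in> \<W> \<and> orbit_of G y \<in> W \<and> h \<in> G \<and> y \<in> h ` V (c W)" if y: "y \<in> ?S" for y
  proof -
    have yQ: "orbit_of G y \<in> topspace ?Q" using y by (simp add: topspace_orbit_space)
    obtain B where B: "openin ?Q B" "orbit_of G y \<in> B" "finite {A \<in> \<W>. A \<inter> B \<noteq> {}}"
      using \<W>(4) yQ unfolding locally_finite_in_def by blast
    obtain W where W: "W \<in> \<W>" "orbit_of G y \<in> W" using \<W>(2) yQ by blast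
    then obtain v where "v \<in> V (c W)" "orbit_of G y = orbit_of G v" using c(2) by blast
    \<comment> \<open>\<open>W\<close> controls only orbits, so \<open>y\<close> itself may lie
      outside \<open>V (c W)\<close>; \<open>h\<close> records a translate that contains it.\<close>
    then have "\<exists>h\<in>G. y \<in> h ` V (c W)"
      using orbit_of_self[OF G y] by (auto simp: orbit_of_def)
    then show ?thesis using B W by blast
  qed
  then have "\<forall>y\<in>?S. \<exists>B W h. openin ?Q B \<and> orbit_of G y \<in> B \<and> finite {A \<in> \<W>. A \<inter> B \<noteq> {}} \<and>
      W \<in> \<W> \<and> orbit_of G y \<in> W \<and> h \<in> G \<and> y \<in> h ` V (c W)"
    by blast
  then obtain B W h where BWh: "\<forall>y\<in>?S. openin ?Q (B y) \<and> orbit_of G y \<in> B y \<and>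
      finite {A \<in> \<W>. A \<inter> B y \<noteq> {}} \<and> W y \<in> \<W> \<and> orbit_of G y \<in> W y \<and> h y \<in> G \<and>
      y \<in> h y ` V (c (W y))"
    unfolding bchoice_iff by blast
  \<comment> \<open>The translates of \<open>M y\<close> star refine the cover: if one of them meets a translate of \<open>M z\<close>,
    then \<open>W y\<close> meets \<open>B z\<close>, so \<open>W y\<close> is among the finitely many indices \<open>A\<close> used for \<open>M z\<close>.\<close>
  define M where "M = (\<lambda>y. {z \<in> ?S. orbit_of G z \<in> B y} \<inter> {z \<in> ?S. orbit_of G z \<in> W y} \<inter>
      h y ` V (c (W y)) \<inter> (\<Inter>A\<in>{A \<in> \<W>. A \<inter> B y \<noteq> {}}. N (c A) y))"
  have M: "openin X (M y) \<and> y \<in> M y" if y: "y \<in> ?S" for y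
  proof
    \<comment> \<open>The orbit of \<open>y\<close> lies in both \<open>W y\<close> and
      \<open>B y\<close>. An empty index set would make the intersection the whole type, which need
      not be open in X.\<close>
    have ne: "{A \<in> \<W>. A \<inter> B y \<noteq> {}} \<noteq> {}" using BWh y by blast
    have "openin X (\<Inter>A\<in>{A \<in> \<W>. A \<inter> B y \<noteq> {}}. N (c A) y)"
      using BWh y UVN c(1) by (intro openin_INT2 ne) auto
    moreover have "openin X {z \<in> ?S. orbit_of G z \<in> B y}" "openin X {z \<in> ?S. orbit_of G z \<in> W y}"
      using BWh y \<W>(1) unfolding openin_orbit_space by blast+
    moreover have "openin X (h y ` V (c (W y)))"
      using BWh y UVN c(1) homeomorphism_group_openin_image[OF G] by blast
    ultimately show "openin X (M y)" unfolding M_def by blast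
    show "y \<in> M y" unfolding M_def using BWh y UVN c(1) by blast
  qed
  have MS: "M y \<subseteq> ?S" for y unfolding M_def by blast
  let ?\<V> = "{g ` M y | g y. g \<in> G \<and> y \<in> ?S}"
  have "star_refines ?\<V> \<U>"
    unfolding star_refines_def
  proof
    fix A assume "A \<in> ?\<V>"
    then obtain g y where g: "g \<in> G" "y \<in> ?S" "A = g ` M y" by blast
    define x where "x = c (W y)"
    have Wy: "W y \<in> \<W>" "h y \<in> G" and x: "x \<in> ?S" using BWh g c by (auto simp: x_def)
    \<comment> \<open>\<open>k\<close> carries \<open>V x\<close> onto a set containing
      \<open>A\<close> and depends on \<open>A\<close> alone, so the image of \<open>U x\<close>
      under \<open>k\<close> can serve for every \<open>A'\<close> at once.\<close>
    obtain k where k: "k \<in> G" "\<And>x. x \<in> ?S \<Longrightarrow> k x = g (h y x)"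
      using homeomorphism_group_compose[OF G g(1) Wy(2)] by blast
    obtain l where l: "l \<in> G" "\<And>x. x \<in> ?S \<Longrightarrow> l (k x) = x" "\<And>x. x \<in> ?S \<Longrightarrow> k (l x) = x"
      using homeomorphism_group_inverse[OF G k(1)] by blast
    show "\<exists>U\<in>\<U>. \<forall>A'\<in>?\<V>. A \<inter> A' \<noteq> {} \<longrightarrow> A' \<subseteq> U"
    proof (intro bexI[of _ "k ` U x"] ballI impI)
      show "k ` U x \<in> \<U>"
        using k(1) UVN x cover unfolding invariant_open_cover_def by blast
      fix A' assume "A' \<in> ?\<V>" and meet: "A \<inter> A' \<noteq> {}"
      then obtain g' z where g': "g' \<in> G" "z \<in> ?S" "A' = g' ` M z" by blast
      obtain a b where a: "a \<in> M y" and b: "b \<in> M z" and ab: "g a = g' b"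
        using meet unfolding g(3) g'(3) by blast
      have aS: "a \<in> ?S" and bS: "b \<in> ?S" using a b MS by auto
      have "orbit_of G a = orbit_of G b"
        using orbit_of_eq[OF G g(1) aS] orbit_of_eq[OF G g'(1) bS] ab by simp
      then have "orbit_of G b \<in> W y \<inter> B z" using a b unfolding M_def by auto
      then have MN: "M z \<subseteq> N x z" using Wy(1) unfolding M_def x_def by blast
      obtain v where v: "v \<in> V x" "a = h y v" using a unfolding M_def x_def by blast
      have vS: "v \<in> ?S" using v UVN x openin_subset by blast
      \<comment> \<open>\<open>m\<close> is \<open>g'\<close> followed by the inverse of
        \<open>k\<close>. It sends \<open>b\<close> to \<open>v\<close> in \<open>V x\<close>, so
        the condition on \<open>N x z\<close> applies to \<open>m\<close>.\<close>
      obtain m where m: "m \<in> G" "\<And>x. x \<in> ?S \<Longrightarrow> m x = l (g' x)"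
        using homeomorphism_group_compose[OF G l(1) g'(1)] by blast
      have "m b = v" using m(2)[OF bS] ab v(2) k(2)[OF vS] l(2)[OF vS] by simp
      then have "m ` N x z \<inter> V x \<noteq> {}" using v(1) b MN by blast
      then have mU: "m ` N x z \<subseteq> U x" using UVN x g'(2) m(1) by blast
      show "A' \<subseteq> k ` U x"
      proof
        fix w assume "w \<in> A'"
        then obtain q where q: "q \<in> M z" "w = g' q" unfolding g'(3) by blast
        then have qS: "q \<in> ?S" using MS by blast
        have "k (m q) = w"
          using m(2)[OF qS] l(3) homeomorphism_group_mapsto[OF G g'(1) qS] q(2) by simp
        moreover have "m q \<in> U x" using mU MN q(1) by blast
        ultimately show "w \<in> k ` U x" by blast
      qed
    qed
  qed
  then show thesis
    using that invariant_open_cover_translates[OF G, of M] M by blast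
qed

section \<open>From invariant covers to invariant gauges\<close>

definition cover_entourage :: "'a set set \<Rightarrow> ('a \<times> 'a) set" where
  "cover_entourage \<U> = (\<Union>U\<in>\<U>. U \<times> U)"

lemma invariant_gauge_of_cover:
  assumes G: "homeomorphism_group X G"
    and para: "paracompact_space (orbit_space X G)"
    and equi: "equiregular X G"
    and cover: "invariant_open_cover X G \<U>"
  obtains \<sigma> where "\<sigma> \<in> invariant_gauges X G"
    "\<And>x y. x \<in> topspace X \<Longrightarrow> y \<in> topspace X \<Longrightarrow> \<sigma> x y < 1/2 \<Longrightarrow> \<exists>U\<in>\<U>. x \<in> U \<and> y \<in> U"
proof -
  let ?S = "topspace X"
  \<comment> \<open>The clause for \<open>n = 0\<close> is part of the invariant only to make
    dependent choice start at the given cover.\<close>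
  have "\<exists>C. \<forall>n. (invariant_open_cover X G (C n) \<and> (n = 0 \<longrightarrow> C n = \<U>)) \<and>
      star_refines (C (Suc n)) (C n)"
    by (rule dependent_nat_choice) (use cover invariant_star_refinement[OF G para equi] in \<open>blast+\<close>)
  then obtain C where C: "\<And>n. invariant_open_cover X G (C n)" "C 0 = \<U>"
      "\<And>n. star_refines (C (Suc n)) (C n)" by blast
  \<comment> \<open>The full square is put in front to satisfy \<open>E_0\<close>, which shifts the
    covers by one: \<open>E 1\<close> comes from the given cover, hence the threshold 1/2 in the
    conclusion.\<close>
  define E where "E = (\<lambda>n. case n of 0 \<Rightarrow> ?S \<times> ?S | Suc m \<Rightarrow> cover_entourage (C m))"
  have C_open: "openin X U" if "U \<in> C n" for U n
    using C(1) that unfolding invariant_open_cover_def by blast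
  have C_cover: "\<exists>U\<in>C n. x \<in> U" if "x \<in> ?S" for x n
    using C(1)[of n] that unfolding invariant_open_cover_def by blast
  have E_sub: "E n \<subseteq> ?S \<times> ?S" for n
    using openin_subset[OF C_open, of _ "n - 1"] by (cases n) (auto simp: E_def cover_entourage_def)
  interpret normal_sequence ?S E
  proof
    show "E 0 = ?S \<times> ?S" by (simp add: E_def)
    show "(x, x) \<in> E n" if "x \<in> ?S" for x n
      using C_cover[OF that, of "n - 1"] that by (cases n) (auto simp: E_def cover_entourage_def)
    show "(y, x) \<in> E n" if "(x, y) \<in> E n" for x y n
      using that by (auto simp: E_def cover_entourage_def split: nat.splits)
    show "E n \<subseteq> ?S \<times> ?S" for n by (rule E_sub)
    fix x y z w n
    assume xy: "(x, y) \<in> E (Suc n)" and yz: "(y, z) \<in> E (Suc n)" and zw: "(z, w) \<in> E (Suc n)"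
    show "(x, w) \<in> E n"
    proof (cases n)
      case 0
      then show ?thesis using subsetD[OF E_sub xy] subsetD[OF E_sub zw] by (simp add: E_def)
    next
      case (Suc m)
      obtain A where A: "A \<in> C n" "x \<in> A" "y \<in> A" using xy by (auto simp: E_def cover_entourage_def)
      obtain B where B: "B \<in> C n" "y \<in> B" "z \<in> B" using yz by (auto simp: E_def cover_entourage_def)
      obtain D where D: "D \<in> C n" "z \<in> D" "w \<in> D" using zw by (auto simp: E_def cover_entourage_def)
      \<comment> \<open>The star of the middle set \<open>B\<close> is used: \<open>A\<close> meets
        \<open>B\<close> in \<open>y\<close>, and \<open>D\<close> meets it in
        \<open>z\<close>.\<close>
      have "star_refines (C n) (C m)" using C(3) Suc by simp
      then obtain U where U: "U \<in> C m" "\<forall>V\<in>C n. B \<inter> V \<noteq> {} \<longrightarrow> V \<subseteq> U"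
        using B(1) unfolding star_refines_def by meson
      have "x \<in> U" using U(2) A B by blast
      moreover have "w \<in> U" using U(2) B D by blast
      ultimately show ?thesis using U(1) Suc by (auto simp: E_def cover_entourage_def)
    qed
  qed
  let ?d = "chain_dist ?S E"
  have open_ball: "openin X (gauge_ball X ?d x \<epsilon>)" if x: "x \<in> ?S" for x \<epsilon>
  proof (subst openin_subopen, intro ballI)
    fix y assume "y \<in> gauge_ball X ?d x \<epsilon>"
    then have y: "y \<in> ?S" "?d x y < \<epsilon>" by (auto simp: gauge_ball_def)
    obtain n where n: "(1/2) ^ n < \<epsilon> - ?d x y"
      using real_arch_pow_inv[of "\<epsilon> - ?d x y" "1/2"] y by auto
    obtain U where U: "U \<in> C n" "y \<in> U" using C_cover y by blast
    have "U \<subseteq> gauge_ball X ?d x \<epsilon>"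
    proof
      fix z assume z: "z \<in> U"
      then have zS: "z \<in> ?S" using U C_open openin_subset by blast
      have "(y, z) \<in> E (Suc n)" using U z by (auto simp: E_def cover_entourage_def)
      then have "(y, z) \<in> E n" using E_antimono[of n "Suc n"] by auto
      then have "?d y z < \<epsilon> - ?d x y" using chain_dist_le n by force
      then show "z \<in> gauge_ball X ?d x \<epsilon>"
        using chain_dist_triangle[OF x y(1) zS] zS by (simp add: gauge_ball_def)
    qed
    then show "\<exists>T. openin X T \<and> y \<in> T \<and> T \<subseteq> gauge_ball X ?d x \<epsilon>"
      using U C_open by blast
  qed
  have "gauge_on X ?d"
    unfolding gauge_on_def
    using chain_dist_nonneg chain_dist_refl chain_dist_sym chain_dist_triangle open_ball by blast
  moreover have "?d (g x) (g y) = ?d x y" if g: "g \<in> G" and xy: "x \<in> ?S" "y \<in> ?S" for g x y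
  proof -
    have le: "?d (g x) (g y) \<le> ?d x y" if g: "g \<in> G" and xy: "x \<in> ?S" "y \<in> ?S" for g x y
    proof (rule chain_dist_image_le[OF xy])
      show "g ` ?S \<subseteq> ?S" using homeomorphism_group_mapsto[OF G g] by blast
      fix n a b assume ab: "(a, b) \<in> E n"
      show "(g a, g b) \<in> E n"
      proof (cases n)
        case 0
        then show ?thesis using ab homeomorphism_group_mapsto[OF G g] by (simp add: E_def)
      next
        case (Suc m)
        then obtain U where U: "U \<in> C m" "a \<in> U" "b \<in> U"
          using ab by (auto simp: E_def cover_entourage_def)
        have "g ` U \<in> C m"
          using U(1) C(1) g unfolding invariant_open_cover_def by blast
        then have "(g a, g b) \<in> cover_entourage (C m)"
          unfolding cover_entourage_def by (rule UN_I) (use U in simp)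
        then show ?thesis by (simp add: E_def Suc)
      qed
    qed
    \<comment> \<open>Applying \<open>le\<close> to the inverse of \<open>g\<close> turns the
      inequality into equality.\<close>
    obtain k where k: "k \<in> G" "\<And>x. x \<in> ?S \<Longrightarrow> k (g x) = x"
      by (rule homeomorphism_group_inverse[OF G g]) simp
    show ?thesis
    proof (rule antisym[OF le[OF g xy]])
      show "?d x y \<le> ?d (g x) (g y)"
        using le[OF k(1), of "g x" "g y"] k(2) xy homeomorphism_group_mapsto[OF G g] by simp
    qed
  qed
  ultimately have "?d \<in> invariant_gauges X G"
    by (simp add: invariant_gauges_def gauges_invariant_def)
  moreover have "\<exists>U\<in>\<U>. x \<in> U \<and> y \<in> U" if "x \<in> ?S" "y \<in> ?S" "?d x y < 1/2" for x y
  proof -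
    have "(x, y) \<in> E (Suc 0)" using that by (intro chain_dist_less_imp) auto
    then have "(x, y) \<in> cover_entourage \<U>" by (simp add: E_def C(2))
    then show ?thesis unfolding cover_entourage_def by blast
  qed
  ultimately show thesis by (rule that)
qed

text \<open>Apply the gauge construction to the cover by translates of the sets \<open>N y\<close>
  belonging to \<open>x\<close> and \<open>U\<close>. A point at distance below 1/2 from
  \<open>x\<close> shares a translate with \<open>x\<close>; that translate meets \<open>V\<close>
  in \<open>x\<close>, and so lies in \<open>U\<close>.\<close>

lemma equiregular_imp_isometrizable:
  assumes X: "Hausdorff_space X" and G: "homeomorphism_group X G"
    and para: "paracompact_space (orbit_space X G)"
    and equi: "equiregular X G"
  shows "isometrizable X G"
proof (rule isometrizableI[OF X])
  fix x U assume U: "openin X U" "x \<in> U"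
  let ?S = "topspace X"
  obtain V N where V: "openin X V" "x \<in> V"
    and N: "\<forall>y\<in>?S. openin X (N y) \<and> y \<in> N y \<and> (\<forall>g\<in>G. g ` N y \<inter> V \<noteq> {} \<longrightarrow> g ` N y \<subseteq> U)"
    by (rule equiregularE[OF equi U])
  have xS: "x \<in> ?S" using U openin_subset by blast
  obtain \<sigma> where \<sigma>: "\<sigma> \<in> invariant_gauges X G"
    "\<And>x y. x \<in> ?S \<Longrightarrow> y \<in> ?S \<Longrightarrow> \<sigma> x y < 1/2 \<Longrightarrow>
      \<exists>A\<in>{g ` N y | g y. g \<in> G \<and> y \<in> ?S}. x \<in> A \<and> y \<in> A"
    using invariant_gauge_of_cover[OF G para equi invariant_open_cover_translates[OF G, of N]] N
    by blast
  have "gauge_ball X \<sigma> x (1/2) \<subseteq> U"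
  proof
    fix y assume "y \<in> gauge_ball X \<sigma> x (1/2)"
    then obtain g z where "g \<in> G" "z \<in> ?S" "x \<in> g ` N z" "y \<in> g ` N z"
      using \<sigma>(2)[OF xS] unfolding gauge_ball_def by blast
    then show "y \<in> U" using N V(2) by blast
  qed
  then show "\<exists>\<sigma>\<in>invariant_gauges X G. \<exists>\<epsilon>>0. gauge_ball X \<sigma> x \<epsilon> \<subseteq> U"
    using \<sigma>(1) by (intro bexI[of _ \<sigma>] exI[of _ "1/2"]) auto
qed

theorem mainTheorem1:
  fixes X :: "'a topology" and G :: "('a \<Rightarrow> 'a) set"
  assumes "Hausdorff_space X"
    and "homeomorphism_group X G"
    and "paracompact_space (orbit_space X G)"
    and "regular_space (orbit_space X G)"
  shows "isometrizable X G \<longleftrightarrow> equiregular X G"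
  using assms isometrizable_imp_equiregular equiregular_imp_isometrizable by blast

end
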